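(* Let $G$ be a non-abelian group of (invertible) affine maps of $\mathbb{R}$. (i) If $G\setminus\mathcal{S}_1\neq\emptyset$, then every orbit of $G$ is dense in $\mathbb{R}$. (ii) If $G\subset\mathcal{S}_1$, then either all orbits of $G$ are dense in $\mathbb{R}$ or all orbits of $G$ are closed and discrete.
   Context: The invertible affine maps of $\mathbb{R}$ are the maps $x\mapsto\lambda x+a$ with $\lambda\in\mathbb{R}\setminus\{0\}$, $a\in\mathbb{R}$; the group law is composition. $\mathcal{S}_1$ is the group of maps $x\mapsto\varepsilon x+a$ with $\varepsilon\in\{-1,1\}$, $a\in\mathbb{R}$. The orbit of $v\in\mathbb{R}$ is $G(v)=\{f(v):f\in G\}$. *)

theory Defs
  imports "HOL-Analysis.Analysis" "HOL-Algebra.Group_Action"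
begin

definition affine_group :: "(real \<Rightarrow> real) monoid" where
  "affine_group =
     \<lparr>carrier = {f. \<exists>c a. c \<noteq> 0 \<and> f = (\<lambda>x. c * x + a)}, mult = (\<circ>), one = id\<rparr>"

definition S1 :: "(real \<Rightarrow> real) set" where
  "S1 = {f. \<exists>\<epsilon>\<in>{-1, 1}. \<exists>a. f = (\<lambda>x. \<epsilon> * x + a)}"

lemma affine_groupI: "c \<noteq> 0 \<Longrightarrow> (\<lambda>x. c * x + a) \<in> carrier affine_group"
  unfolding affine_group_def by auto

lemma affine_groupE:
  assumes "f \<in> carrier affine_group"
  obtains c a where "c \<noteq> 0" "f = (\<lambda>x. c * x + a)"
  using assms unfolding affine_group_def by auto

lemma mult_affine_group: "f \<otimes>\<^bsub>affine_group\<^esub> g = f \<circ> g"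
  and one_affine_group: "\<one>\<^bsub>affine_group\<^esub> = id"
  by (simp_all add: affine_group_def)

lemma group_affine_group: "group affine_group"
proof (rule groupI)
  fix f g assume "f \<in> carrier affine_group" "g \<in> carrier affine_group"
  then obtain b a d c where *: "b \<noteq> 0" "f = (\<lambda>x. b * x + a)" "d \<noteq> 0" "g = (\<lambda>x. d * x + c)"
    by (elim affine_groupE) blast
  have "f \<circ> g = (\<lambda>x. (b * d) * x + (b * c + a))"
    unfolding * by (simp add: fun_eq_iff algebra_simps)
  moreover have "b * d \<noteq> 0" using * by simp
  ultimately show "f \<otimes>\<^bsub>affine_group\<^esub> g \<in> carrier affine_group"
    by (simp only: mult_affine_group affine_groupI not_False_eq_True)
next
  have "id = (\<lambda>x::real. 1 * x + 0)" by (simp add: fun_eq_iff)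
  then show "\<one>\<^bsub>affine_group\<^esub> \<in> carrier affine_group"
    by (metis affine_groupI one_affine_group zero_neq_one)
next
  fix f assume "f \<in> carrier affine_group"
  then obtain b a where f: "b \<noteq> 0" "f = (\<lambda>x. b * x + a)"
    by (rule affine_groupE)
  let ?g = "\<lambda>x. inverse b * x + (- a / b)"
  have "?g \<circ> f = id" using f(1) unfolding f(2) by (simp add: fun_eq_iff field_simps)
  moreover have "?g \<in> carrier affine_group" using f(1) by (intro affine_groupI) simp
  ultimately show "\<exists>g\<in>carrier affine_group. g \<otimes>\<^bsub>affine_group\<^esub> f = \<one>\<^bsub>affine_group\<^esub>"
    unfolding mult_affine_group one_affine_group by blast
qed (simp_all add: mult_affine_group one_affine_group comp_assoc)

end

(*
  Two non-commuting elements have a nontrivial translation as commutator. Let T be the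
  additive group of all a such that x + a lies in G. If T has arbitrarily small positive
  elements, it is dense, and so is every orbit, since the orbit of v contains v + T.
  This happens if some element of G has slope c with abs c different from 1, because
  conjugation by it multiplies T by c. If G is contained in S1, the orbit of v is the union
  of v + T and of the points a - v, where a ranges over the constant terms of the
  reflections in G. Two such constants differ by an element of T, so that if T has
  no small positive elements both parts are uniformly discrete.
*)
theory Submission
  imports Defs
begin

text \<open>The kernel of the slope homomorphism on G, recorded by its constant terms. Writing
  \<open>1 * x\<close> makes it the slope 1 case of the form \<open>c * x + a\<close> used
  throughout.\<close>

definition translation_part :: "(real \<Rightarrow> real) set \<Rightarrow> real set" where
  "translation_part G = {a. (\<lambda>x. 1 * x + a) \<in> G}"

section \<open>Dense subgroups, discrete unions and geometric decay\<close>

text \<open>The integer multiples of one positive h < e in T, shifted by v, form a grid of mesh less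
  than e.\<close>

lemma closure_translate_additive_subgroup:
  fixes T :: "real set"
  assumes "0 \<in> T" and add: "\<And>a b. a \<in> T \<Longrightarrow> b \<in> T \<Longrightarrow> a + b \<in> T"
    and neg: "\<And>a. a \<in> T \<Longrightarrow> - a \<in> T"
    and small: "\<And>e. e > 0 \<Longrightarrow> \<exists>h\<in>T. 0 < h \<and> h < e"
  shows "closure ((+) v ` T) = UNIV"
proof -
  have nat_mult: "real n * h \<in> T" if "h \<in> T" for h and n :: nat
    using that assms(1) by (induction n) (auto simp: algebra_simps intro: add)
  have int_mult: "of_int k * h \<in> T" if "h \<in> T" for h and k :: int
    using nat_mult[OF that] neg[OF nat_mult[OF that]] by (cases k rule: int_cases2) auto
  have "\<exists>y\<in>(+) v ` T. dist y x < e" if e: "e > 0" for x e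
  proof -
    obtain h where h: "h \<in> T" "0 < h" "h < e"
      using small[OF e] by blast
    \<comment> \<open>Chosen so that \<open>v + of_int ?k * h\<close> is the last grid point not
      exceeding x; it is then closer to x than h.\<close>
    let ?k = "\<lfloor>(x - v) / h\<rfloor>"
    have "of_int ?k * h \<le> x - v"
      using h(2) by (simp add: pos_le_divide_eq[symmetric])
    moreover have "x - v < (of_int ?k + 1) * h"
      using h(2) by (simp add: pos_divide_less_eq[symmetric])
    ultimately have "dist (v + of_int ?k * h) x < e"
      using h(3) by (simp add: dist_real_def algebra_simps)
    then show ?thesis
      using int_mult[OF h(1)] by blast
  qed
  then show ?thesis
    by (auto simp: closure_approachable)
qed

text \<open>Plain discreteness does not survive unions, but a uniformly discrete set is also closed
  and so has no limit points anywhere, a property that finite unions inherit. The two sets may come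
  arbitrarily close to each other, so the union need not be uniformly discrete.\<close>

lemma discrete_Un_uniform_discrete:
  fixes A B :: "'a::metric_space set"
  assumes "uniform_discrete A" "uniform_discrete B"
  shows "discrete (A \<union> B)"
proof -
  have "\<not> x islimpt C" if "uniform_discrete C" for x and C :: "'a set"
    using uniform_discrete_imp_closed[OF that] uniform_discrete_imp_discrete[OF that]
    by (auto simp: closed_limpt discrete_def isolated_in_islimpt_iff)
  then show ?thesis
    using assms by (auto simp: discrete_def isolated_in_islimpt_iff islimpt_Un)
qed

text \<open>The action is \<open>id\<close> because the group elements already are maps of the
  line.\<close>

lemma orbit_restrict_eq:
  "orbit (affine_group\<lparr>carrier := G\<rparr>) id v = {f v | f. f \<in> G}"
  by (simp add: orbit_def)

lemma power_abs_less_ex: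
  fixes c t e :: real
  assumes "\<bar>c\<bar> < 1" "e > 0"
  shows "\<exists>n. \<bar>c ^ n * t\<bar> < e"
proof -
  have "(\<lambda>n. c ^ n * t) \<longlonglongrightarrow> 0 * t"
    using assms(1) by (intro tendsto_mult LIMSEQ_power_zero tendsto_const) simp
  then have "\<forall>\<^sub>F n in sequentially. dist (c ^ n * t) 0 < e"
    using assms(2) by (simp add: tendsto_iff)
  then show ?thesis
    by (auto simp: eventually_sequentially)
qed

section \<open>The translation part of a group of affine maps\<close>

context
  fixes G :: "(real \<Rightarrow> real) set"
  assumes subgroup: "subgroup G affine_group"
begin

interpretation affine: group affine_group
  by (rule group_affine_group)

lemma affine_elemE:
  assumes "f \<in> G"
  obtains c a where "c \<noteq> 0" "f = (\<lambda>x. c * x + a)"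
  using subgroup.subset[OF subgroup] assms by (blast elim: affine_groupE)

lemma affine_comp_mem:
  assumes "(\<lambda>x. c * x + a) \<in> G" "(\<lambda>x. d * x + b) \<in> G"
  shows "(\<lambda>x. (c * d) * x + (c * b + a)) \<in> G"
proof -
  have "(\<lambda>x. c * x + a) \<circ> (\<lambda>x. d * x + b) \<in> G"
    using subgroup.m_closed[OF subgroup assms] by (simp add: mult_affine_group)
  also have "(\<lambda>x. c * x + a) \<circ> (\<lambda>x. d * x + b) = (\<lambda>x. (c * d) * x + (c * b + a))"
    by (simp add: fun_eq_iff algebra_simps)
  finally show ?thesis .
qed

lemma affine_inverse_mem:
  assumes "(\<lambda>x. c * x + a) \<in> G" "c \<noteq> 0"
  shows "(\<lambda>x. (1 / c) * x + (- a / c)) \<in> G"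
proof -
  let ?f = "\<lambda>x. c * x + a" and ?g = "\<lambda>x. (1 / c) * x + (- a / c)"
  have "?g \<otimes>\<^bsub>affine_group\<^esub> ?f = \<one>\<^bsub>affine_group\<^esub>"
    using assms(2) by (simp add: mult_affine_group one_affine_group fun_eq_iff field_simps)
  moreover have "?f \<in> carrier affine_group" "?g \<in> carrier affine_group"
    using assms(2) by (intro affine_groupI; simp)+
  ultimately have "inv\<^bsub>affine_group\<^esub> ?f = ?g"
    by (rule affine.inv_equality)
  then show ?thesis
    using subgroup.m_inv_closed[OF subgroup assms(1)] by simp
qed

lemma zero_mem_translation_part: "0 \<in> translation_part G"
  using subgroup.one_closed[OF subgroup]
  by (simp add: translation_part_def one_affine_group id_def)

text \<open>Composing the first map with the inverse of the second cancels the slope c.\<close>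

lemma diff_mem_translation_part:
  assumes "(\<lambda>x. c * x + a) \<in> G" "(\<lambda>x. c * x + b) \<in> G" "c \<noteq> 0"
  shows "a - b \<in> translation_part G"
  using affine_comp_mem[OF assms(1) affine_inverse_mem[OF assms(2,3)]] assms(3)
  by (simp add: translation_part_def)

lemma add_mem_translation_part:
  "a \<in> translation_part G \<Longrightarrow> b \<in> translation_part G \<Longrightarrow> a + b \<in> translation_part G"
  using affine_comp_mem[of 1 b 1 a] by (simp add: translation_part_def)

lemma uminus_mem_translation_part:
  "a \<in> translation_part G \<Longrightarrow> - a \<in> translation_part G"
  using affine_inverse_mem[of 1 a] by (simp add: translation_part_def)

text \<open>This is conjugation of a translation. It is obtained by precomposing the map of slope c
  with the translation by t, which keeps the slope and adds \<open>c * t\<close> to the constant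
  term.\<close>

lemma mult_mem_translation_part:
  assumes "(\<lambda>x. c * x + a) \<in> G" "c \<noteq> 0" "t \<in> translation_part G"
  shows "c * t \<in> translation_part G"
proof -
  have "(\<lambda>x. c * x + (c * t + a)) \<in> G"
    using affine_comp_mem[OF assms(1), of 1 t] assms(3) by (simp add: translation_part_def)
  then show ?thesis
    using diff_mem_translation_part[of c "c * t + a" a] assms(1,2) by simp
qed

lemma power_mult_mem_translation_part:
  assumes "(\<lambda>x. c * x + a) \<in> G" "c \<noteq> 0" "t \<in> translation_part G"
  shows "c ^ n * t \<in> translation_part G"
  using assms(3)
  by (induction n) (simp_all add: mult.assoc mult_mem_translation_part[OF assms(1,2)])

text \<open>Slopes commute, so \<open>f \<circ> g\<close> and \<open>g \<circ> f\<close> both have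
  slope \<open>c * d\<close>. If they differ, they differ in their constant terms, and that
  difference is the translation given by the commutator.\<close>

lemma nonabelian_translation_part:
  assumes "\<not> comm_group (affine_group\<lparr>carrier := G\<rparr>)"
  shows "\<exists>t\<in>translation_part G. t \<noteq> 0"
proof -
  have "\<exists>f\<in>G. \<exists>g\<in>G. f \<circ> g \<noteq> g \<circ> f"
    using group.group_comm_groupI[OF affine.subgroup_imp_group[OF subgroup]] assms
    by (auto simp: mult_affine_group)
  then obtain f g where fg: "f \<in> G" "g \<in> G" "f \<circ> g \<noteq> g \<circ> f"
    by blast
  obtain c a where f: "c \<noteq> 0" "f = (\<lambda>x. c * x + a)"
    using fg(1) by (rule affine_elemE)
  obtain d b where g: "d \<noteq> 0" "g = (\<lambda>x. d * x + b)"
    using fg(2) by (rule affine_elemE)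
  have "(\<lambda>x. (c * d) * x + (c * b + a)) \<in> G" "(\<lambda>x. (c * d) * x + (d * a + b)) \<in> G"
    using fg(1,2) affine_comp_mem[of c a d b] affine_comp_mem[of d b c a]
    by (simp_all add: f g mult.commute)
  then have "(c * b + a) - (d * a + b) \<in> translation_part G"
    by (rule diff_mem_translation_part) (simp add: f g)
  moreover have "(c * b + a) - (d * a + b) \<noteq> 0"
    using fg(3) by (auto simp: f g fun_eq_iff algebra_simps)
  ultimately show ?thesis
    by blast
qed

section \<open>Density and discreteness of orbits\<close>

lemma small_translations_imp_dense_orbit:
  assumes "\<And>e. e > 0 \<Longrightarrow> \<exists>h\<in>translation_part G. 0 < h \<and> h < e"
  shows "closure {f v | f. f \<in> G} = UNIV"
proof -
  have "(+) v ` translation_part G \<subseteq> {f v | f. f \<in> G}"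
    by (force simp: translation_part_def)
  moreover have "closure ((+) v ` translation_part G) = UNIV"
    by (rule closure_translate_additive_subgroup)
      (simp_all add: zero_mem_translation_part add_mem_translation_part
        uminus_mem_translation_part assms)
  ultimately show ?thesis
    using closure_mono by blast
qed

lemma non_isometry_imp_small_translations:
  assumes "t \<in> translation_part G" "t \<noteq> 0" "f \<in> G" "f \<notin> S1" "e > 0"
  shows "\<exists>h\<in>translation_part G. 0 < h \<and> h < e"
proof -
  obtain c a where f: "c \<noteq> 0" "f = (\<lambda>x. c * x + a)"
    using assms(3) by (rule affine_elemE)
  have "\<bar>c\<bar> \<noteq> 1"
    using assms(4) f(2) by (auto simp: S1_def abs_if split: if_splits)
  \<comment> \<open>Either f or its inverse is a contraction; the powers of its slope then shrink t
    below e.\<close>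
  have "\<exists>d b. d \<noteq> 0 \<and> \<bar>d\<bar> < 1 \<and> (\<lambda>x. d * x + b) \<in> G"
  proof (cases "\<bar>c\<bar> < 1")
    case True
    then show ?thesis using assms(3) f by blast
  next
    case False
    then have "\<bar>1 / c\<bar> < 1" "1 / c \<noteq> 0"
      using \<open>\<bar>c\<bar> \<noteq> 1\<close> f(1) by simp_all
    then show ?thesis using affine_inverse_mem[of c a] assms(3) f by blast
  qed
  then obtain d b where d: "d \<noteq> 0" "\<bar>d\<bar> < 1" "(\<lambda>x. d * x + b) \<in> G"
    by blast
  obtain n where n: "\<bar>d ^ n * t\<bar> < e"
    using power_abs_less_ex[OF d(2) assms(5)] by blast
  have "d ^ n * t \<in> translation_part G"
    using d(3,1) assms(1) by (rule power_mult_mem_translation_part)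
  \<comment> \<open>The slope d may be negative, so the sign is removed by symmetry of the
    translation part.\<close>
  then have "\<bar>d ^ n * t\<bar> \<in> translation_part G"
    using uminus_mem_translation_part by (auto simp: abs_if)
  moreover have "\<bar>d ^ n * t\<bar> > 0"
    using d(1) assms(2) by simp
  ultimately show ?thesis
    using n by blast
qed

lemma no_small_translations_imp_closed_discrete_orbit:
  assumes "G \<subseteq> S1" "e > 0" and no_small: "\<And>h. h \<in> translation_part G \<Longrightarrow> 0 < h \<Longrightarrow> e \<le> h"
  shows "closed {f v | f. f \<in> G} \<and> discrete {f v | f. f \<in> G}"
proof -
  \<comment> \<open>The orbit is split by slope: \<open>D 1\<close> is v + T, and
    \<open>D (- 1)\<close> holds the images of v under reflections.\<close>
  define D where "D = (\<lambda>c. {c * v + a | a. (\<lambda>x. c * x + a) \<in> G})"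
  have uniform: "uniform_discrete (D c)" if "c \<noteq> 0" for c
  proof (rule uniformI2[OF \<open>e > 0\<close>])
    fix x y assume "x \<in> D c" "y \<in> D c" "x \<noteq> y"
    then obtain a b where ab: "x = c * v + a" "y = c * v + b"
      "(\<lambda>x. c * x + a) \<in> G" "(\<lambda>x. c * x + b) \<in> G" "a \<noteq> b"
      by (auto simp: D_def)
    \<comment> \<open>Distinct points of one part are separated by a positive translation, hence by
      at least e.\<close>
    then have "\<bar>a - b\<bar> \<in> translation_part G"
      using diff_mem_translation_part[of c a b] diff_mem_translation_part[of c b a] that
      by (auto simp: abs_if)
    then show "e \<le> dist x y"
      using no_small[of "\<bar>a - b\<bar>"] ab by (simp add: dist_real_def)
  qed
  have "{f v | f. f \<in> G} = D 1 \<union> D (- 1)"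
  proof
    show "{f v | f. f \<in> G} \<subseteq> D 1 \<union> D (- 1)"
    proof safe
      fix f assume "f \<in> G" "f v \<notin> D (- 1)"
      moreover from \<open>f \<in> G\<close> assms(1) obtain c a where "c \<in> {- 1, 1}" "f = (\<lambda>x. c * x + a)"
        unfolding S1_def by blast
      ultimately show "f v \<in> D 1"
        unfolding D_def by blast
    qed
    have "D c \<subseteq> {f v | f. f \<in> G}" for c
      unfolding D_def by force
    then show "D 1 \<union> D (- 1) \<subseteq> {f v | f. f \<in> G}"
      by blast
  qed
  moreover have "closed (D 1 \<union> D (- 1))"
    by (intro closed_Un uniform_discrete_imp_closed uniform) simp_all
  moreover have "discrete (D 1 \<union> D (- 1))"
    by (intro discrete_Un_uniform_discrete uniform) simp_all
  ultimately show ?thesis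
    by simp
qed

end

theorem corollary1p8:
  fixes G :: "(real \<Rightarrow> real) set"
  assumes "subgroup G affine_group"
    and "\<not> comm_group (affine_group\<lparr>carrier := G\<rparr>)"
  shows "(G - S1 \<noteq> {} \<longrightarrow>
            (\<forall>v. closure (orbit (affine_group\<lparr>carrier := G\<rparr>) id v) = UNIV)) \<and>
         (G \<subseteq> S1 \<longrightarrow>
            (\<forall>v. closure (orbit (affine_group\<lparr>carrier := G\<rparr>) id v) = UNIV) \<or>
            (\<forall>v. closed (orbit (affine_group\<lparr>carrier := G\<rparr>) id v) \<and>
                 discrete (orbit (affine_group\<lparr>carrier := G\<rparr>) id v)))"
proof -
  obtain t where t: "t \<in> translation_part G" "t \<noteq> 0"
    using nonabelian_translation_part[OF assms] by blast
  have "closure {f v | f. f \<in> G} = UNIV" if "G - S1 \<noteq> {}" for v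
    using that small_translations_imp_dense_orbit[OF assms(1)]
      non_isometry_imp_small_translations[OF assms(1) t] by blast
  moreover have "(\<forall>v. closure {f v | f. f \<in> G} = UNIV) \<or>
      (\<forall>v. closed {f v | f. f \<in> G} \<and> discrete {f v | f. f \<in> G})" if "G \<subseteq> S1"
  \<comment> \<open>The condition does not mention v, so the same alternative holds for all orbits
    at once.\<close>
  proof (cases "\<forall>e>0. \<exists>h\<in>translation_part G. 0 < h \<and> h < e")
    case True
    then show ?thesis
      using small_translations_imp_dense_orbit[OF assms(1)] by blast
  next
    case False
    then obtain e where "e > 0" "\<And>h. h \<in> translation_part G \<Longrightarrow> 0 < h \<Longrightarrow> e \<le> h"
      by (meson not_le)
    then show ?thesis
      using no_small_translations_imp_closed_discrete_orbit[OF assms(1) that] by blast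
  qed
  ultimately show ?thesis
    unfolding orbit_restrict_eq by blast
qed

end
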